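(* Let $G=(V(G),E(G))$ be a graph. Then $$\gamma_{coe}\big(G^{\frac{1}{3}}\big)=|V(G)|.$$
   Context: All graphs are finite and simple. A set $D\subseteq V$ is a dominating set of a graph $H=(V,E)$ if every vertex of $V-D$ is adjacent to at least one vertex of $D$. A dominating set $D$ is a co-even dominating set of $H$ if the degree (in $H$) of every vertex of $V-D$ is even. The co-even domination number $\gamma_{coe}(H)$ is the minimum cardinality of a co-even dominating set of $H$. For a positive integer $k$, the $k$-subdivision $G^{\frac{1}{k}}$ of a graph $G$ is the graph obtained by replacing each edge $uv$ of $G$ with a path of length $k$ (i.e. with $k$ edges) joining $u$ and $v$, whose $k-1$ internal vertices are new and distinct for distinct edges; thus $G^{\frac{1}{k}}$ has $|V(G)|+(k-1)|E(G)|$ vertices and $k|E(G)|$ edges. *)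

theory Defs
  imports "Graph_Theory.Pair_Digraph"
begin

text \<open>
  Finite simple graphs are the \<^locale>\<open>pair_graph\<close>s of the Graph Theory library: finite, loop-free,
  symmetric sets of arcs. An undirected edge is a pair of opposite arcs, so the degree of a vertex is
  its out-degree.
\<close>

definition dominating_set :: "'a pair_pre_digraph \<Rightarrow> 'a set \<Rightarrow> bool" where
  "dominating_set H D \<longleftrightarrow>
     D \<subseteq> pverts H \<and> (\<forall>v \<in> pverts H - D. \<exists>u \<in> D. (v, u) \<in> parcs H)"

definition co_even_dominating_set :: "'a pair_pre_digraph \<Rightarrow> 'a set \<Rightarrow> bool" where
  "co_even_dominating_set H D \<longleftrightarrow>
     dominating_set H D \<and> (\<forall>v \<in> pverts H - D. even (out_degree (with_proj H) v))"

text \<open>For finite \<open>H\<close> the minimum is over a finite set, which is nonempty because \<open>pverts H\<close> itself is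
  co-even dominating.\<close>

definition co_even_domination_number :: "'a pair_pre_digraph \<Rightarrow> nat" where
  "co_even_domination_number H = Min (card ` {D. co_even_dominating_set H D})"

text \<open>
  The \<open>i\<close>-th internal vertex of the path replacing the edge \<open>uv\<close>, counted from \<open>u\<close>, is the
  \<open>(k - i)\<close>-th one counted from \<open>v\<close>. It is represented by the set of both descriptions, which makes
  the construction independent of an orientation of the edges.
\<close>

datatype 'a subdivision_vertex = Original 'a | Internal "('a \<times> 'a \<times> nat) set"

definition path_vertex :: "nat \<Rightarrow> 'a \<Rightarrow> 'a \<Rightarrow> nat \<Rightarrow> 'a subdivision_vertex" where
  "path_vertex k u v i =
     (if i = 0 then Original u
      else if i = k then Original v
      else Internal {(u, v, i), (v, u, k - i)})"

text \<open>
  Each edge \<open>uv\<close> of \<open>G\<close> contributes the arcs of its path in both directions, since both \<open>(u, v)\<close> and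
  \<open>(v, u)\<close> are arcs of \<open>G\<close>. Only \<open>k > 0\<close> is meaningful.
\<close>

definition k_subdivision :: "nat \<Rightarrow> 'a pair_pre_digraph \<Rightarrow> 'a subdivision_vertex pair_pre_digraph" where
  "k_subdivision k G =
     \<lparr> pverts = Original ` pverts G
         \<union> {path_vertex k u v i | u v i. (u, v) \<in> parcs G \<and> 0 < i \<and> i < k},
       parcs = {(path_vertex k u v i, path_vertex k u v (Suc i)) | u v i.
         (u, v) \<in> parcs G \<and> i < k} \<rparr>"

lemma path_vertex_rev: "i \<le> k \<Longrightarrow> 0 < k \<Longrightarrow> path_vertex k v u (k - i) = path_vertex k u v i"
  by (auto simp: path_vertex_def)

lemma path_vertex_inner_eq_iff:
  assumes "0 < i" "i < k" "0 < j" "j < k"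
  shows "path_vertex k u v i = path_vertex k x y j \<longleftrightarrow>
    (x = u \<and> y = v \<and> j = i) \<or> (x = v \<and> y = u \<and> j = k - i)"
  using assms by (auto simp: path_vertex_def doubleton_eq_iff)

lemma path_vertex_in_pverts:
  assumes "pair_graph G" "(u, v) \<in> parcs G" "i \<le> k"
  shows "path_vertex k u v i \<in> pverts (k_subdivision k G)"
proof -
  interpret pair_graph G by fact
  have "u \<in> pverts G" "v \<in> pverts G"
    using assms(2) arc_fst_in_verts arc_snd_in_verts by fastforce+
  then consider "i = 0" | "i = k" | "0 < i" "i < k" using assms(3) by linarith
  then show ?thesis
  proof cases
    case 3
    with assms show ?thesis by (auto simp: k_subdivision_def)
  qed (use \<open>u \<in> pverts G\<close> \<open>v \<in> pverts G\<close> in \<open>auto simp: k_subdivision_def path_vertex_def\<close>)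
qed

lemma pair_graph_k_subdivision:
  assumes "pair_graph G"
  shows "pair_graph (k_subdivision k G)"
proof -
  interpret G: pair_graph G by fact
  let ?S = "k_subdivision k G"
  let ?I = "(\<lambda>((u, v), i). path_vertex k u v i)"
  have fin: "finite (parcs G \<times> {..k})" by simp
  have 1: "pverts ?S \<subseteq> Original ` pverts G \<union> ?I ` (parcs G \<times> {..k})"
    by (force simp: k_subdivision_def)
  have 2: "parcs ?S \<subseteq> ?I ` (parcs G \<times> {..k}) \<times> ?I ` (parcs G \<times> {..k})"
    by (force simp: k_subdivision_def)
  show ?thesis
  proof
    fix e assume "e \<in> parcs ?S"
    then obtain u v i where e: "e = (path_vertex k u v i, path_vertex k u v (Suc i))"
      and uv: "(u, v) \<in> parcs G" and i: "i < k"
      by (auto simp: k_subdivision_def)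
    show "fst e \<in> pverts ?S" "snd e \<in> pverts ?S"
      using path_vertex_in_pverts[OF assms uv] i by (auto simp: e)
    have "u \<noteq> v" using G.no_loops uv by fastforce
    then show "fst e \<noteq> snd e"
      using i by (auto simp: e path_vertex_def doubleton_eq_iff)
  next
    show "finite (pverts ?S)" by (rule finite_subset[OF 1]) (use fin in auto)
    show "finite (parcs ?S)" by (rule finite_subset[OF 2]) (use fin in auto)
    show "symmetric (with_proj ?S)"
    proof -
      have "(b, a) \<in> parcs ?S" if ab: "(a, b) \<in> parcs ?S" for a b
      proof -
        obtain u v i where a: "a = path_vertex k u v i" and b: "b = path_vertex k u v (Suc i)"
          and uv: "(u, v) \<in> parcs G" and i: "i < k"
          using ab by (auto simp: k_subdivision_def)
        have "(v, u) \<in> parcs G" using uv G.arcs_symmetric by blast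
        moreover have "b = path_vertex k v u (k - Suc i)" "a = path_vertex k v u (Suc (k - Suc i))"
          using path_vertex_rev[of "Suc i" k v u] path_vertex_rev[of i k v u] i
          by (simp_all add: a b Suc_diff_Suc)
        ultimately show ?thesis using i unfolding k_subdivision_def by fastforce
      qed
      then show ?thesis by (auto simp: symmetric_def sym_def)
    qed
  qed
qed

text \<open>
  The expected numbers of vertices and edges; \<open>card (parcs _)\<close> is twice the number of edges.
\<close>

lemma card_parcs_k_subdivision:
  assumes "pair_graph G"
  shows "card (parcs (k_subdivision k G)) = k * card (parcs G)"
proof -
  interpret G: pair_graph G by fact
  define f where "f = (\<lambda>((u :: 'a, v :: 'a), i). (path_vertex k u v i, path_vertex k u v (Suc i)))"
  have im: "parcs (k_subdivision k G) = f ` (parcs G \<times> {..<k})"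
    by (force simp: k_subdivision_def f_def)
  have "inj_on f (parcs G \<times> {..<k})"
  proof (rule inj_onI)
    fix p q assume p: "p \<in> parcs G \<times> {..<k}" and q: "q \<in> parcs G \<times> {..<k}" and eq: "f p = f q"
    obtain u v i x y j where pq: "p = ((u, v), i)" "q = ((x, y), j)"
      by (metis surj_pair)
    have "u \<noteq> v" "x \<noteq> y" using p q pq G.no_loops by fastforce+
    moreover have "i < k" "j < k" using p q pq by auto
    ultimately show "p = q"
      using eq unfolding pq f_def path_vertex_def
      by (auto simp: doubleton_eq_iff split: if_splits)
  qed
  then show ?thesis by (simp add: im card_image card_cartesian_product)
qed

lemma card_pverts_k_subdivision:
  assumes "pair_graph G"
  shows "2 * card (pverts (k_subdivision k G)) = 2 * card (pverts G) + (k - 1) * card (parcs G)"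
proof -
  interpret G: pair_graph G by fact
  define f where "f = (\<lambda>((u :: 'a, v :: 'a), i). path_vertex k u v i)"
  let ?P = "parcs G \<times> {0<..<k}"
  have fin: "finite ?P" by simp
  have im: "pverts (k_subdivision k G) = Original ` pverts G \<union> f ` ?P"
    by (force simp: k_subdivision_def f_def)
  have fib: "card {p \<in> ?P. f p = y} = 2" if "y \<in> f ` ?P" for y
  proof -
    obtain u v i where uv: "(u, v) \<in> parcs G" and i: "0 < i" "i < k" and y: "y = path_vertex k u v i"
      using \<open>y \<in> f ` ?P\<close> by (auto simp: f_def)
    have "(v, u) \<in> parcs G" using uv G.arcs_symmetric by blast
    moreover have "u \<noteq> v" using G.no_loops uv by fastforce
    ultimately have "{p \<in> ?P. f p = y} = {((u, v), i), ((v, u), k - i)}"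
      using uv i by (auto simp: f_def y path_vertex_inner_eq_iff)
    then show ?thesis using \<open>u \<noteq> v\<close> by simp
  qed
  have "card ?P = (\<Sum>y \<in> f ` ?P. card {p \<in> ?P. f p = y})"
    using sum.image_gen[OF fin, of "\<lambda>_. 1 :: nat" f] by simp
  also have "\<dots> = 2 * card (f ` ?P)" using fib by simp
  finally have "2 * card (f ` ?P) = (k - 1) * card (parcs G)"
    by (simp add: card_cartesian_product mult.commute)
  moreover have "Original ` pverts G \<inter> f ` ?P = {}" by (auto simp: f_def path_vertex_def)
  ultimately show ?thesis
    unfolding im using fin by (subst card_Un_disjoint) (auto simp: card_image inj_on_def)
qed

end

theory Submission
  imports Defs
begin

text \<open>
  The original vertices dominate the 3-subdivision, and the remaining vertices all have degree 2.
  Conversely, the closed neighbourhoods of the original vertices are pairwise disjoint, and every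
  dominating set meets each of them.
\<close>

lemma parcs_k_subdivisionI:
  "(u, v) \<in> parcs G \<Longrightarrow> i < k \<Longrightarrow>
     (path_vertex k u v i, path_vertex k u v (Suc i)) \<in> parcs (k_subdivision k G)"
  unfolding k_subdivision_def by auto

text \<open>Each arc is listed with a tail index \<open>i < k\<close>, so an original vertex can be
  a tail only at index 0. The far end, index \<open>k\<close>, is a tail only when the path is read
  in the opposite orientation.\<close>

lemma parcs_k_subdivision_Original_iff:
  "(Original u, y) \<in> parcs (k_subdivision k G) \<longleftrightarrow>
     0 < k \<and> (\<exists>v. (u, v) \<in> parcs G \<and> y = path_vertex k u v 1)"
    (is "?L \<longleftrightarrow> ?R")
proof
  assume ?L
  then obtain x v i where "(x, v) \<in> parcs G" "i < k" "Original u = path_vertex k x v i"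
    and "y = path_vertex k x v (Suc i)"
    by (auto simp: k_subdivision_def)
  then show ?R by (auto simp: path_vertex_def split: if_splits)
next
  assume ?R
  then obtain v where "0 < k" "(u, v) \<in> parcs G" "y = path_vertex k u v (Suc 0)"
    by auto
  moreover have "Original u = path_vertex k u v 0" by (simp add: path_vertex_def)
  ultimately show ?L using parcs_k_subdivisionI[of u v G 0 k] by simp
qed

text \<open>An inner vertex has exactly two descriptions, one per orientation of its edge. The
  successor in one orientation is the predecessor in the other.\<close>

lemma parcs_k_subdivision_inner_iff:
  assumes "pair_graph G" "(u, v) \<in> parcs G" "0 < i" "i < k"
  shows "(path_vertex k u v i, y) \<in> parcs (k_subdivision k G) \<longleftrightarrow>
    y = path_vertex k u v (Suc i) \<or> y = path_vertex k u v (i - 1)"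
    (is "?L \<longleftrightarrow> ?R")
proof
  assume ?L
  then obtain x z j where eq: "path_vertex k u v i = path_vertex k x z j"
    and y: "y = path_vertex k x z (Suc j)" and "j < k"
    by (auto simp: k_subdivision_def)
  \<comment> \<open>Index 0 would give an \<open>Original\<close> vertex, while the left side of
    \<open>eq\<close> is \<open>Internal\<close>.\<close>
  have "0 < j" using eq assms(3,4) by (auto simp: path_vertex_def split: if_splits)
  then consider "x = u" "z = v" "j = i" | "x = v" "z = u" "j = k - i"
    using eq assms(3,4) \<open>j < k\<close> by (auto simp: path_vertex_inner_eq_iff)
  then show ?R
  proof cases
    case 2
    \<comment> \<open>The successor counted from \<open>v\<close> is rewritten as a vertex counted
      from \<open>u\<close>; with truncated subtraction this relies on \<open>0 < i\<close>.\<close>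
    have "Suc (k - i) = k - (i - 1)" using assms(3,4) by simp
    then show ?thesis
      using 2 y assms(3,4) path_vertex_rev[of "i - 1" k v u] by simp
  qed (use y in simp)
next
  interpret pair_graph "k_subdivision k G" by (rule pair_graph_k_subdivision) fact
  assume ?R
  then show ?L
  proof
    assume "y = path_vertex k u v (i - 1)"
    then show ?L
      using parcs_k_subdivisionI[OF assms(2), of "i - 1" k] assms(3,4) arcs_symmetric by simp
  qed (simp add: parcs_k_subdivisionI assms)
qed

lemma out_degree_k_subdivision_inner:
  assumes "pair_graph G" "(u, v) \<in> parcs G" "0 < i" "i < k"
  shows "out_degree (with_proj (k_subdivision k G)) (path_vertex k u v i) = 2"
proof -
  interpret pair_graph G by fact
  let ?p = "path_vertex k u v"
  have "u \<noteq> v" using assms(2) no_loops by fastforce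
  \<comment> \<open>Looplessness matters at the midpoint: for \<open>k = 2 * i\<close>, the two
    neighbours would coincide if \<open>u = v\<close>.\<close>
  then have "?p (Suc i) \<noteq> ?p (i - 1)"
    using assms(3,4) by (auto simp: path_vertex_def doubleton_eq_iff)
  moreover have "out_arcs (with_proj (k_subdivision k G)) (?p i)
      = Pair (?p i) ` {y. (?p i, y) \<in> parcs (k_subdivision k G)}"
    by (auto simp: out_arcs_def)
  then have "out_arcs (with_proj (k_subdivision k G)) (?p i)
      = {(?p i, ?p (Suc i)), (?p i, ?p (i - 1))}"
    unfolding parcs_k_subdivision_inner_iff[OF assms] by blast
  ultimately show ?thesis by (simp add: out_degree_def)
qed

lemma co_even_dominating_set_Original:
  assumes "pair_graph G"
  shows "co_even_dominating_set (k_subdivision 3 G) (Original ` pverts G)"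
proof -
  interpret pair_graph G by fact
  have "(\<exists>x \<in> Original ` pverts G. (w, x) \<in> parcs (k_subdivision 3 G))
      \<and> even (out_degree (with_proj (k_subdivision 3 G)) w)"
    if w_in: "w \<in> pverts (k_subdivision 3 G) - Original ` pverts G" for w
  proof -
    obtain u v i where w: "w = path_vertex 3 u v i" and uv: "(u, v) \<in> parcs G"
      and i: "0 < i" "i < 3"
      using w_in unfolding k_subdivision_def by (auto simp: k_subdivision_def)
    have "u \<in> pverts G" "v \<in> pverts G"
      using uv arc_fst_in_verts arc_snd_in_verts by fastforce+
    \<comment> \<open>For \<open>k = 3\<close> each inner vertex is next to an end of its
      path.\<close>
    moreover have "i - 1 = 0 \<or> Suc i = 3" using i by linarith
    then have "(w, Original u) \<in> parcs (k_subdivision 3 G)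
        \<or> (w, Original v) \<in> parcs (k_subdivision 3 G)"
      unfolding w parcs_k_subdivision_inner_iff[OF assms uv i] by (auto simp: path_vertex_def)
    ultimately show ?thesis
      using out_degree_k_subdivision_inner[OF assms uv i] w by auto
  qed
  moreover have "Original ` pverts G \<subseteq> pverts (k_subdivision 3 G)"
    by (simp add: k_subdivision_def)
  ultimately show ?thesis
    unfolding co_even_dominating_set_def dominating_set_def by blast
qed

lemma card_le_dominating_set_k_subdivision:
  assumes "3 \<le> k" "finite D" and D: "dominating_set (k_subdivision k G) D"
  shows "card (pverts G) \<le> card D"
proof -
  \<comment> \<open>Here \<open>v\<close> ranges over all of \<open>'a\<close>, which enlarges the
    closed neighbourhood of \<open>Original u\<close>; the enlarged sets are still pairwise
    disjoint.\<close>
  have "\<exists>d \<in> D. d = Original u \<or> (\<exists>v. d = path_vertex k u v 1)" if "u \<in> pverts G" for u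
  proof (cases "Original u \<in> D")
    case False
    then have "Original u \<in> pverts (k_subdivision k G) - D"
      using that by (simp add: k_subdivision_def)
    then obtain d where "d \<in> D" "(Original u, d) \<in> parcs (k_subdivision k G)"
      using D unfolding dominating_set_def by blast
    then show ?thesis unfolding parcs_k_subdivision_Original_iff by blast
  qed auto
  then obtain f where f: "\<And>u. u \<in> pverts G \<Longrightarrow>
      f u \<in> D \<and> (f u = Original u \<or> (\<exists>v. f u = path_vertex k u v 1))"
    by metis
  \<comment> \<open>Two first inner vertices with different starting points could agree only as
    opposite readings of one edge, which forces \<open>k - 1 = 1\<close>. This is excluded by
    \<open>3 \<le> k\<close>.\<close>
  have "u = x" if "u \<in> pverts G" "x \<in> pverts G" "f u = f x" for u x
    using f[OF that(1)] f[OF that(2)] that(3) \<open>3 \<le> k\<close>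
    by (auto simp: path_vertex_def doubleton_eq_iff)
  then have "inj_on f (pverts G)" by (rule inj_onI)
  then show ?thesis using f \<open>finite D\<close> by (intro card_inj_on_le) auto
qed

theorem theorem3p5:
  fixes G :: "'a pair_pre_digraph"
  assumes "pair_graph G"
  shows "co_even_domination_number (k_subdivision 3 G) = card (pverts G)"
proof -
  interpret S: pair_graph "k_subdivision 3 G" by (rule pair_graph_k_subdivision) fact
  let ?C = "{D. co_even_dominating_set (k_subdivision 3 G) D}"
  \<comment> \<open>This inclusion gives both the finiteness required by \<open>Min\<close> and that
    of each single \<open>D\<close>, without which \<open>card D\<close> would be 0.\<close>
  have sub: "?C \<subseteq> Pow (pverts (k_subdivision 3 G))"
    by (auto simp: co_even_dominating_set_def dominating_set_def)
  show ?thesis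
    unfolding co_even_domination_number_def
  proof (rule Min_eqI)
    show "finite (card ` ?C)"
      using finite_subset[OF sub] by simp
    show "card (pverts G) \<in> card ` ?C"
      using co_even_dominating_set_Original[OF assms]
      by (intro image_eqI[of _ _ "Original ` pverts G"]) (auto simp: card_image inj_on_def)
    fix n assume "n \<in> card ` ?C"
    then obtain D where "n = card D" and D: "D \<in> ?C" by auto
    moreover have "finite D" using D sub by (meson PowD S.pair_finite_verts finite_subset subsetD)
    ultimately show "card (pverts G) \<le> n"
      using card_le_dominating_set_k_subdivision[of 3 D G]
      by (simp add: co_even_dominating_set_def)
  qed
qed

end
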